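(* For all integers $r$, $\lambda$ and $t$ with $r\ge 2$, $2\le\lambda\le\frac{1}{2}r$ and $t\ge 2$, there exist infinitely many $\lambda$-edge-connected $r$-regular hypergraphs $\mathcal{H}$ with $|V(\mathcal{H})|$ even and rank at least $t$ such that $\mathcal{H}$ does not have a Berge $k$-factor for any odd integer $k$ with $k<\frac{1}{\lambda}r$.
   Context: A hypergraph has a finite vertex set and a finite multiset of edges, each a vertex subset of size at least two; its rank is the maximum edge size, and it is $r$-regular if every vertex lies in exactly $r$ edges. A Berge-path is an alternating sequence of distinct vertices and distinct edges $v_1,e_1,\dots,e_l,v_{l+1}$ with $\{v_i,v_{i+1}\}\subseteq e_i$; the hypergraph is $\lambda$-edge-connected if after deleting any at most $\lambda-1$ edges every two vertices are still joined by a Berge-path. A Berge $k$-factor is a spanning subhypergraph $\mathcal{H}'$ for which there is a $k$-regular graph $G$ (multiple edges allowed) on $V(\mathcal{H})$ and a bijection $\phi:E(G)\to E(\mathcal{H}')$ with $e\subseteq\phi(e)$ for all $e$. *)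

theory Defs
  imports Complex_Main "HOL-Library.Multiset"
begin

record 'a pre_hypergraph =
  verts :: "'a set"
  edges :: "'a set multiset"

definition hypergraph :: "'a pre_hypergraph \<Rightarrow> bool" where
  "hypergraph H \<longleftrightarrow> finite (verts H) \<and> (\<forall>e \<in># edges H. e \<subseteq> verts H \<and> 2 \<le> card e)"

text \<open>Loopless, with multiple edges allowed.\<close>

definition multigraph :: "'a pre_hypergraph \<Rightarrow> bool" where
  "multigraph G \<longleftrightarrow> hypergraph G \<and> (\<forall>e \<in># edges G. card e = 2)"

text \<open>The inserted \<open>0\<close> only matters for hypergraphs without edges, which get rank \<open>0\<close>.\<close>

definition hrank :: "'a pre_hypergraph \<Rightarrow> nat" where
  "hrank H = Max (insert 0 (card ` set_mset (edges H)))"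

definition degree :: "'a pre_hypergraph \<Rightarrow> 'a \<Rightarrow> nat" where
  "degree H v = size {#e \<in># edges H. v \<in> e#}"

definition regular :: "nat \<Rightarrow> 'a pre_hypergraph \<Rightarrow> bool" where
  "regular r H \<longleftrightarrow> (\<forall>v \<in> verts H. degree H v = r)"

text \<open>
  The edges of a path are distinct as members of the multiset of edges: parallel edges are different
  edges, so a vertex subset may be repeated up to its multiplicity.
\<close>

definition berge_path :: "'a pre_hypergraph \<Rightarrow> 'a \<Rightarrow> 'a list \<Rightarrow> 'a set list \<Rightarrow> 'a \<Rightarrow> bool" where
  "berge_path H u vs es v \<longleftrightarrow>
     length vs = length es + 1 \<and> hd vs = u \<and> last vs = v \<and>
     distinct vs \<and> set vs \<subseteq> verts H \<and> mset es \<subseteq># edges H \<and>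
     (\<forall>i < length es. {vs ! i, vs ! (i + 1)} \<subseteq> es ! i)"

definition berge_connected :: "'a pre_hypergraph \<Rightarrow> bool" where
  "berge_connected H \<longleftrightarrow> (\<forall>u \<in> verts H. \<forall>v \<in> verts H. \<exists>vs es. berge_path H u vs es v)"

definition delete_edges :: "'a pre_hypergraph \<Rightarrow> 'a set multiset \<Rightarrow> 'a pre_hypergraph" where
  "delete_edges H F = \<lparr>verts = verts H, edges = edges H - F\<rparr>"

text \<open>
  \<open>size F < l\<close> expresses ``at most \<open>l - 1\<close> edges'' without truncated subtraction.
\<close>

definition edge_connected :: "nat \<Rightarrow> 'a pre_hypergraph \<Rightarrow> bool" where
  "edge_connected l H \<longleftrightarrow>
     (\<forall>F. F \<subseteq># edges H \<and> size F < l \<longrightarrow> berge_connected (delete_edges H F))"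

definition spanning_subhypergraph :: "'a pre_hypergraph \<Rightarrow> 'a pre_hypergraph \<Rightarrow> bool" where
  "spanning_subhypergraph H' H \<longleftrightarrow> verts H' = verts H \<and> edges H' \<subseteq># edges H"

text \<open>
  The individual edges, with parallel edges told apart by an index, so that maps between edge
  multisets can be written as functions.
\<close>

definition edge_occs :: "'a pre_hypergraph \<Rightarrow> ('a set \<times> nat) set" where
  "edge_occs H = (SIGMA e : set_mset (edges H). {..<count (edges H) e})"

definition berge_factor :: "nat \<Rightarrow> 'a pre_hypergraph \<Rightarrow> 'a pre_hypergraph \<Rightarrow> bool" where
  "berge_factor k H' H \<longleftrightarrow> spanning_subhypergraph H' H \<and>
     (\<exists>G \<phi>. multigraph G \<and> verts G = verts H \<and> regular k G \<and>
        bij_betw \<phi> (edge_occs G) (edge_occs H') \<and>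
        (\<forall>e \<in> edge_occs G. fst e \<subseteq> fst (\<phi> e)))"

definition hiso :: "'a pre_hypergraph \<Rightarrow> 'b pre_hypergraph \<Rightarrow> bool" where
  "hiso G H \<longleftrightarrow>
     (\<exists>f. bij_betw f (verts G) (verts H) \<and> image_mset ((`) f) (edges G) = edges H)"

end

theory Submission
  imports Defs
begin

text \<open>
  Take \<open>2 * l\<close> hubs and \<open>2 * r\<close> disjoint blobs of odd size \<open>n\<close>, and link every blob \<open>C\<close> to \<open>l\<close>
  hubs \<open>s\<close> by edges \<open>insert s C\<close>, such that every hub is linked to \<open>r\<close> blobs; \<open>r - l\<close> copies of
  the edge \<open>C\<close> bring the degrees in \<open>C\<close> up to \<open>r\<close>.  For odd \<open>k\<close>, the degree sum of a \<open>k\<close>-regular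
  graph over a blob is odd, so some edge leaves the blob, and in a Berge factor that edge must end
  in a hub.  Hence the hubs have degree sum at least \<open>2 * r\<close>, whereas it equals \<open>2 * l * k < 2 * r\<close>.

  After deleting fewer than \<open>l\<close> edges, every blob keeps a link to some hub, and two hubs with at
  least \<open>l\<close> common blobs keep both links to one of these; the hubs are connected by such pairs.
\<close>

section \<open>Reachability and Berge-paths\<close>

text \<open>Walks along \<open>linked\<close> may repeat vertices and edges, which makes
  reachability easier to establish than a Berge-path.\<close>

definition linked :: "'a pre_hypergraph \<Rightarrow> ('a \<times> 'a) set" where
  "linked H = {(u, v). v \<in> verts H \<and> (\<exists>e \<in># edges H. {u, v} \<subseteq> e)}"

text \<open>Appending \<open>e\<close> and \<open>w\<close> could repeat a vertex or an edge, so the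
  path is first cut: at \<open>w\<close> if it already passes through \<open>w\<close>, and
  otherwise at its first vertex in \<open>e\<close>.\<close>

lemma berge_path_step:
  assumes p: "berge_path H u vs es v"
    and e: "e \<in># edges H" "{v, w} \<subseteq> e" and w: "w \<in> verts H"
  shows "\<exists>vs es. berge_path H u vs es w"
proof (cases "w \<in> set vs")
  case True
  then obtain i where i: "i < length vs" "vs ! i = w" by (meson in_set_conv_nth)
  have len: "length vs = length es + 1" using p by (simp add: berge_path_def)
  have "mset (take i es) \<subseteq># edges H"
    using p unfolding berge_path_def
    by (metis append_take_drop_id mset_append mset_subset_eq_add_left subset_mset.order_trans)
  moreover have last: "last (take (Suc i) vs) = w" using i by (simp add: take_Suc_conv_app_nth)
  ultimately have "berge_path H u (take (Suc i) vs) (take i es) w"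
    using p i len set_take_subset[of "Suc i" vs] last
    by (auto simp: berge_path_def hd_conv_nth min_def)
  then show ?thesis by blast
next
  case False
  have len: "length vs = length es + 1" and ne: "vs \<noteq> []"
    using p by (auto simp: berge_path_def)
  have ex: "length es < length vs \<and> vs ! length es \<in> e"
    using p e len ne by (auto simp: berge_path_def last_conv_nth)
  \<comment> \<open>Leaving the path at its first vertex in \<open>e\<close> ensures that \<open>e\<close> has not been used before.\<close>
  define i where "i = (LEAST i. i < length vs \<and> vs ! i \<in> e)"
  have i: "i < length vs" "vs ! i \<in> e"
    using LeastI[of "\<lambda>i. i < length vs \<and> vs ! i \<in> e", OF ex] by (auto simp: i_def)
  have least: "vs ! j \<notin> e" if "j < i" for j
    using not_less_Least[of j "\<lambda>i. i < length vs \<and> vs ! i \<in> e"] that i(1) by (auto simp: i_def)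
  \<comment> \<open>If \<open>e\<close> had been used before position \<open>i\<close>, the vertex
    preceding it would be an earlier vertex in \<open>e\<close>.\<close>
  have notin: "e \<notin> set (take i es)"
  proof
    assume "e \<in> set (take i es)"
    then obtain j where "j < i" "j < length es" "es ! j = e"
      by (auto simp: in_set_conv_nth)
    then show False using p least by (auto simp: berge_path_def)
  qed
  have sub: "mset (take i es) \<subseteq># edges H"
    using p unfolding berge_path_def
    by (metis append_take_drop_id mset_append mset_subset_eq_add_left subset_mset.order_trans)
  \<comment> \<open>Distinctness of edges is inclusion of multisets: \<open>e\<close> is absent from
    the kept part and has a copy in \<open>edges H\<close>.\<close>
  have "mset (take i es @ [e]) \<subseteq># edges H"
  proof (rule mset_subset_eqI)
    fix a
    have "count (mset (take i es)) e = 0" "1 \<le> count (edges H) e"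
      using notin e(1) by (simp_all add: Suc_le_eq)
    then show "count (mset (take i es @ [e])) a \<le> count (edges H) a"
      using mset_subset_eq_count[OF sub, of a]
      by (cases "a = e") (simp_all del: count_eq_zero_iff count_mset_0_iff)
  qed
  moreover have "distinct (take (Suc i) vs @ [w])" "set (take (Suc i) vs @ [w]) \<subseteq> verts H"
    using p False w set_take_subset[of "Suc i" vs] by (auto simp: berge_path_def)
  moreover have "{(take (Suc i) vs @ [w]) ! j, (take (Suc i) vs @ [w]) ! (j + 1)} \<subseteq> (take i es @ [e]) ! j"
    if "j < length (take i es @ [e])" for j
  proof (cases "j < i")
    case True
    then show ?thesis using p i len by (auto simp: berge_path_def nth_append)
  next
    case False
    then have "j = i" using that by simp
    then show ?thesis using i e(2) len by (auto simp: nth_append)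
  qed
  ultimately have "berge_path H u (take (Suc i) vs @ [w]) (take i es @ [e]) w"
    using p i len ne unfolding berge_path_def by (auto simp: hd_append)
  then show ?thesis by blast
qed

lemma linked_rtrancl_berge_path:
  assumes "(u, v) \<in> (linked H)\<^sup>*" "u \<in> verts H"
  shows "\<exists>vs es. berge_path H u vs es v"
  using assms
proof (induction rule: rtrancl_induct)
  case base
  then have "berge_path H u [u] [] u" by (simp add: berge_path_def)
  then show ?case by blast
next
  case (step v w)
  then show ?case using berge_path_step[of H u _ _ v _ w] by (auto simp: linked_def)
qed

text \<open>The vertex \<open>c\<close> is a relay. Both directions are asked for because
  \<open>linked\<close> constrains only its target to \<open>verts H\<close>, so it need not be
  symmetric.\<close>

lemma berge_connectedI:
  assumes "\<And>v. v \<in> verts H \<Longrightarrow> (c, v) \<in> (linked H)\<^sup>* \<and> (v, c) \<in> (linked H)\<^sup>*"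
  shows "berge_connected H"
  unfolding berge_connected_def
  using assms linked_rtrancl_berge_path[of _ _ H] by (meson rtrancl_trans)

section \<open>Counting tools and the graph behind a Berge factor\<close>

text \<open>Double counting of incidences; it serves the parity over a blob as well as the total
  over the hubs.\<close>

lemma sum_degree:
  assumes "finite A"
  shows "(\<Sum>v\<in>A. degree H v) = (\<Sum>e\<in>#edges H. card (e \<inter> A))"
proof -
  have "(\<Sum>v\<in>A. size {#e \<in># M. v \<in> e#}) = (\<Sum>e\<in>#M. card (e \<inter> A))" for M :: "'a set multiset"
  proof (induction M)
    case (add e M)
    have "(\<Sum>v\<in>A. size {#x \<in># add_mset e M. v \<in> x#})
        = (\<Sum>v\<in>A. of_bool (v \<in> e) + size {#x \<in># M. v \<in> x#})"
      by (intro sum.cong) auto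
    also have "\<dots> = card (e \<inter> A) + (\<Sum>v\<in>A. size {#x \<in># M. v \<in> x#})"
      using assms by (simp add: sum.distrib Int_commute)
    finally show ?case using add.IH by simp
  qed simp
  then show ?thesis by (simp add: degree_def)
qed

text \<open>Pigeonhole: otherwise each index has a deleted edge in its own \<open>X i\<close>, and
  by disjointness these are \<open>card I\<close> different members of \<open>F\<close>.\<close>

lemma ex_surviving_index:
  assumes "size F < card I" "finite I"
    and "\<And>i j. i \<in> I \<Longrightarrow> j \<in> I \<Longrightarrow> i \<noteq> j \<Longrightarrow> X i \<inter> X j = {}"
  shows "\<exists>i\<in>I. \<forall>e\<in>X i. e \<notin># F"
proof (rule ccontr)
  assume "\<not> ?thesis"
  then have "\<forall>i\<in>I. \<exists>e. e \<in> X i \<and> e \<in># F" by blast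
  from bchoice[OF this] obtain f where f: "\<And>i. i \<in> I \<Longrightarrow> f i \<in> X i \<and> f i \<in># F" by blast
  have "inj_on f I"
  proof (rule inj_onI, rule ccontr)
    fix i j assume "i \<in> I" "j \<in> I" "f i = f j" "i \<noteq> j"
    then show False using f[of i] f[of j] assms(3)[of i j] by auto
  qed
  then have "card I \<le> card (set_mset F)"
    using f by (intro card_inj_on_le) auto
  also have "\<dots> \<le> size F"
    by (metis card_mono finite_set_mset mset_set_set_mset_msubset size_mset_mono size_mset_set)
  finally show False using assms(1) by simp
qed

lemma hiso_card_verts: "hiso G H \<Longrightarrow> card (verts G) = card (verts H)"
  by (auto simp: hiso_def bij_betw_same_card)

text \<open>Turns the exclusion of Berge factors into a question about regular multigraphs whose
  edges lie inside edges of \<open>H\<close>.\<close>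

lemma berge_factor_graph:
  assumes "berge_factor k H' H"
  obtains G where "multigraph G" "verts G = verts H" "regular k G"
    "\<And>e. e \<in># edges G \<Longrightarrow> \<exists>e' \<in># edges H. e \<subseteq> e'"
proof -
  obtain G \<phi> where G: "multigraph G" "verts G = verts H" "regular k G"
    and bij: "bij_betw \<phi> (edge_occs G) (edge_occs H')"
    and sub: "\<forall>e \<in> edge_occs G. fst e \<subseteq> fst (\<phi> e)" and H': "edges H' \<subseteq># edges H"
    using assms by (auto simp: berge_factor_def spanning_subhypergraph_def)
  have "\<exists>e' \<in># edges H. e \<subseteq> e'" if "e \<in># edges G" for e
  proof -
    \<comment> \<open>Index \<open>0\<close> is available because the multiplicity of
      \<open>e\<close> is positive.\<close>
    have e: "(e, 0) \<in> edge_occs G" using that by (auto simp: edge_occs_def)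
    then have "\<phi> (e, 0) \<in> edge_occs H'" using bij by (auto simp: bij_betw_def)
    then have "fst (\<phi> (e, 0)) \<in># edges H" using H' by (auto simp: edge_occs_def dest: mset_subset_eqD)
    then show ?thesis using sub e by (metis fst_conv)
  qed
  then show ?thesis using that G by blast
qed

section \<open>The construction\<close>

text \<open>The hubs are the numbers below \<open>2 * l\<close>, and the blobs are consecutive
  intervals after them.\<close>

definition blob :: "nat \<Rightarrow> nat \<Rightarrow> nat \<Rightarrow> nat set" where
  "blob l n i = {2 * l + i * n ..< 2 * l + (i + 1) * n}"

definition half :: "nat \<Rightarrow> nat \<Rightarrow> nat set" where
  "half l i = (if i < l then {1..l} else {..<l})"

text \<open>
  Blobs \<open>i\<close> and \<open>r + i\<close> are linked to complementary sets of hubs, so every hub is linked to exactly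
  \<open>r\<close> blobs, whatever \<open>half\<close> is.  The two values of \<open>half\<close> overlap, and each is taken at least \<open>l\<close>
  times, which keeps the hubs connected.
\<close>

definition hubs :: "nat \<Rightarrow> nat \<Rightarrow> nat \<Rightarrow> nat set" where
  "hubs r l i = (if i < r then half l i else {..<2 * l} - half l (i - r))"

definition blob_edges :: "nat \<Rightarrow> nat \<Rightarrow> nat \<Rightarrow> nat \<Rightarrow> nat set multiset" where
  "blob_edges r l n i =
     replicate_mset (r - l) (blob l n i) +
     image_mset (\<lambda>s. insert s (blob l n i)) (mset_set (hubs r l i))"

definition hub_hypergraph :: "nat \<Rightarrow> nat \<Rightarrow> nat \<Rightarrow> nat pre_hypergraph" where
  "hub_hypergraph r l n =
     \<lparr>verts = {..<2 * l} \<union> (\<Union>i<2 * r. blob l n i),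
      edges = (\<Sum>i<2 * r. blob_edges r l n i)\<rparr>"

text \<open>\<open>2 \<le> l\<close> makes the two values of \<open>half\<close> overlap,
  \<open>2 * l \<le> r\<close> lets each occur at least \<open>l\<close> times, and
  \<open>2 \<le> n\<close> makes a blob large enough to be an edge. Oddness of \<open>n\<close>
  enters only with the parity argument.\<close>

locale hub_construction =
  fixes r l n :: nat
  assumes l: "2 \<le> l" and r: "2 * l \<le> r" and n: "2 \<le> n"
begin

abbreviation "H \<equiv> hub_hypergraph r l n"
abbreviation "C \<equiv> blob l n"
abbreviation "N \<equiv> hubs r l"

lemma card_blob: "card (C i) = n" and finite_blob: "finite (C i)"
  by (auto simp: blob_def)

lemma blob_nonempty: "C i \<noteq> {}"
  using n card_blob[of i] by auto

lemma blob_disjoint: "i \<noteq> j \<Longrightarrow> C i \<inter> C j = {}"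
proof (induction i j rule: linorder_wlog)
  case (le i j)
  then have "(i + 1) * n \<le> j * n" by (intro mult_le_mono1) simp
  then show ?case by (auto simp: blob_def)
qed (simp add: Int_commute)

lemma blob_hubs_disjoint: "v \<in> C i \<Longrightarrow> \<not> v < 2 * l"
  by (simp add: blob_def)

lemma blob_index_eq: "v \<in> C i \<Longrightarrow> v \<in> C j \<Longrightarrow> i = j"
  using blob_disjoint by blast

lemma half_subset: "half l i \<subseteq> {..<2 * l}"
  using l by (auto simp: half_def)

lemma card_half: "card (half l i) = l"
  by (simp add: half_def)

lemma hubs_subset: "N i \<subseteq> {..<2 * l}"
  using half_subset by (auto simp: hubs_def)

lemma finite_hubs: "finite (N i)"
  using hubs_subset finite_subset by blast

lemma card_hubs: "card (N i) = l"
  using half_subset[of "i - r"] finite_subset[OF half_subset]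
  by (simp add: hubs_def card_half card_Diff_subset)

text \<open>\<open>C i\<close> itself is an edge because the number \<open>r - l\<close> of its
  copies is positive.\<close>

lemma edges_hub_hypergraph:
  "e \<in># edges H \<longleftrightarrow> (\<exists>i<2 * r. e = C i \<or> (\<exists>s\<in>N i. e = insert s (C i)))"
  using r l finite_hubs
  by (auto simp: hub_hypergraph_def blob_edges_def set_mset_sum)

lemma hub_not_in_blob: "s \<in> N i \<Longrightarrow> s \<notin> C j"
  using hubs_subset[of i] blob_hubs_disjoint[of s j] by auto

lemma card_insert_hub: "s \<in> N i \<Longrightarrow> card (insert s (C i)) = n + 1"
  by (simp add: finite_blob card_blob hub_not_in_blob)

lemma finite_verts: "finite (verts H)"
  by (auto simp: hub_hypergraph_def finite_blob)

lemma card_verts: "card (verts H) = 2 * l + 2 * r * n"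
proof -
  have "card (\<Union>i<2 * r. C i) = 2 * r * n"
    by (subst card_UN_disjoint) (auto simp: finite_blob card_blob dest: blob_index_eq)
  moreover have "{..<2 * l} \<inter> (\<Union>i<2 * r. C i) = {}" using blob_hubs_disjoint by auto
  ultimately show ?thesis
    by (simp add: hub_hypergraph_def card_Un_disjoint finite_blob)
qed

lemma hypergraph_hub: "hypergraph H"
  unfolding hypergraph_def
proof (intro conjI ballI finite_verts)
  fix e assume "e \<in># edges H"
  then obtain i where i: "i < 2 * r" "e = C i \<or> (\<exists>s\<in>N i. e = insert s (C i))"
    by (auto simp: edges_hub_hypergraph)
  then show "e \<subseteq> verts H" using hubs_subset[of i] by (auto simp: hub_hypergraph_def)
  show "2 \<le> card e" using i n card_insert_hub card_blob by auto
qed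

lemma hrank_hub: "n \<le> hrank H"
proof -
  have "C 0 \<in># edges H" using l r by (auto simp: edges_hub_hypergraph intro!: exI[of _ 0])
  then have "card (C 0) \<le> hrank H" unfolding hrank_def by (intro Max_ge) auto
  then show ?thesis by (simp add: card_blob)
qed

section \<open>Degrees and regularity\<close>

lemma sum_hubs:
  assumes "s < 2 * l"
  shows "(\<Sum>i<2 * r. of_bool (s \<in> N i)) = r"
proof -
  \<comment> \<open>Splitting the range in the middle pairs \<open>i\<close> with
    \<open>i + r\<close>, whose hub sets are complementary.\<close>
  have "(\<Sum>i<2 * r. f i) = (\<Sum>i<r. f i) + (\<Sum>i<r. f (i + r))" for f :: "nat \<Rightarrow> nat"
    using sum.atLeastLessThan_concat[of 0 r "2 * r" f] sum.shift_bounds_nat_ivl[of f 0 r r]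
    by (simp add: lessThan_atLeast0 mult_2)
  then have "(\<Sum>i<2 * r. of_bool (s \<in> N i)) =
      (\<Sum>i<r. of_bool (s \<in> N i)) + (\<Sum>i<r. of_bool (s \<in> N (i + r)) :: nat)" .
  also have "\<dots> = (\<Sum>i<r. of_bool (s \<in> half l i) + of_bool (s \<notin> half l i))"
    using assms by (subst sum.distrib) (auto simp: hubs_def)
  also have "\<dots> = (\<Sum>i<r. 1)" by (intro sum.cong) auto
  finally show ?thesis by simp
qed

lemma degree_hub_hypergraph:
  "degree H v = (\<Sum>i<2 * r. size {#e \<in># blob_edges r l n i. v \<in> e#})"
proof -
  have "size (filter_mset P (\<Sum>i\<in>A. f i)) = (\<Sum>i\<in>A. size (filter_mset P (f i)))"
    if "finite A" for P A and f :: "nat \<Rightarrow> nat set multiset"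
    using that by (induction A) auto
  then show ?thesis by (simp add: degree_def hub_hypergraph_def)
qed

text \<open>A vertex of the blob lies in its \<open>r - l\<close> copies and in all \<open>l\<close>
  links; any other vertex lies at most in the link made by inserting it.\<close>

lemma size_blob_edges:
  "size {#e \<in># blob_edges r l n i. v \<in> e#} = (if v \<in> C i then r else of_bool (v \<in> N i))"
proof -
  have "size {#e \<in># image_mset (\<lambda>s. insert s (C i)) (mset_set (N i)). v \<in> e#} =
      card {s \<in> N i. v \<in> insert s (C i)}"
    by (simp add: filter_mset_image_mset filter_mset_mset_set finite_hubs)
  also have "\<dots> = (if v \<in> C i then l else of_bool (v \<in> N i))"
  proof (cases "v \<in> C i")
    case False
    then have "{s \<in> N i. v \<in> insert s (C i)} = (if v \<in> N i then {v} else {})" by auto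
    then show ?thesis using False by simp
  qed (simp add: card_hubs)
  finally have "size {#e \<in># image_mset (\<lambda>s. insert s (C i)) (mset_set (N i)). v \<in> e#} =
      (if v \<in> C i then l else of_bool (v \<in> N i))" .
  moreover have "filter_mset P (replicate_mset m e) = (if P e then replicate_mset m e else {#})"
    for P m and e :: "nat set"
    by (induction m) auto
  ultimately show ?thesis using r by (simp add: blob_edges_def)
qed

lemma regular_hub: "regular r H"
  unfolding regular_def
proof
  fix v assume "v \<in> verts H"
  then consider "v < 2 * l" | j where "j < 2 * r" "v \<in> C j"
    by (auto simp: hub_hypergraph_def)
  then show "degree H v = r"
  proof cases
    case 1
    then have "\<And>i. v \<notin> C i" using blob_hubs_disjoint by blast
    then show ?thesis using 1 sum_hubs by (simp add: degree_hub_hypergraph size_blob_edges)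
  next
    case 2
    have "size {#e \<in># blob_edges r l n i. v \<in> e#} = (if i = j then r else 0)" for i
    proof (cases "i = j")
      case False
      then have "v \<notin> C i" "v \<notin> N i" using 2 blob_index_eq hub_not_in_blob by blast+
      then show ?thesis using False by (simp add: size_blob_edges)
    qed (use 2 in \<open>simp add: size_blob_edges\<close>)
    then show ?thesis using 2 by (simp add: degree_hub_hypergraph)
  qed
qed

section \<open>Edge-connectivity\<close>

lemma edge_connected_hub: "edge_connected l H"
  unfolding edge_connected_def
proof (intro allI impI)
  fix F assume F: "F \<subseteq># edges H \<and> size F < l"
  let ?D = "delete_edges H F"
  have surv: "e \<in># edges ?D" if "e \<in># edges H" "e \<notin># F" for e
    using that by (simp add: delete_edges_def in_diff_count not_in_iff)
  have V: "verts ?D = verts H" by (simp add: delete_edges_def)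
  have hubV: "s \<in> verts H" if "s < 2 * l" for s
    using that by (auto simp: hub_hypergraph_def)
  \<comment> \<open>Restricting both ends to \<open>verts H\<close> gives a symmetric relation, so
    that its closure \<open>R\<close> is an equivalence.\<close>
  have "sym (linked ?D \<inter> verts H \<times> verts H)"
    by (auto simp: linked_def sym_def V)
  define R where "R = (linked ?D \<inter> verts H \<times> verts H)\<^sup>*"
  have symR: "(u, v) \<in> R \<Longrightarrow> (v, u) \<in> R" for u v
    using sym_rtrancl[OF \<open>sym _\<close>] by (auto simp: R_def sym_def)
  have trR: "(u, v) \<in> R \<Longrightarrow> (v, w) \<in> R \<Longrightarrow> (u, w) \<in> R" for u v w
    by (auto simp: R_def)
  have edgeR: "(u, v) \<in> R" if "e \<in># edges H" "e \<notin># F" "u \<in> e" "v \<in> e" for e u v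
    using that surv[of e] hypergraph_hub
    unfolding R_def by (intro r_into_rtrancl) (auto simp: linked_def V hypergraph_def)
  have blobR: "\<exists>s<2 * l. (s, v) \<in> R" if v: "v \<in> C i" and i: "i < 2 * r" for v i
  proof -
    \<comment> \<open>The \<open>l\<close> links of one blob are different edges, so fewer than
      \<open>l\<close> deletions cannot hit them all.\<close>
    have "\<exists>s\<in>N i. \<forall>e\<in>{insert s (C i)}. e \<notin># F"
    proof (rule ex_surviving_index)
      fix s t assume "s \<in> N i" "t \<in> N i" "s \<noteq> t"
      then show "{insert s (C i)} \<inter> {insert t (C i)} = {}"
        using hubs_subset[of i] blob_hubs_disjoint[of _ i] by blast
    qed (use F card_hubs finite_hubs in auto)
    then obtain s where "s \<in> N i" "insert s (C i) \<notin># F" by blast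
    then show ?thesis
      using edgeR[of "insert s (C i)" s v] i v hubs_subset[of i]
      by (auto simp: edges_hub_hypergraph)
  qed
  have hubsR: "(s, t) \<in> R"
    if I: "I \<subseteq> {..<2 * r}" "\<And>i. i \<in> I \<Longrightarrow> s \<in> N i \<and> t \<in> N i" "l \<le> card I" for s t I
  proof -
    have "\<exists>i\<in>I. \<forall>e\<in>{insert s (C i), insert t (C i)}. e \<notin># F"
    proof (rule ex_surviving_index)
      fix i j assume ij: "i \<in> I" "j \<in> I" "i \<noteq> j"
      \<comment> \<open>If these were equal, a vertex of \<open>C i\<close>, not being the hub
        \<open>y\<close>, would lie in \<open>C j\<close>.\<close>
      have "insert x (C i) \<noteq> insert y (C j)" if "x \<in> {s, t}" "y \<in> {s, t}" for x y
      proof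
        assume eq: "insert x (C i) = insert y (C j)"
        obtain v where v: "v \<in> C i" using blob_nonempty by blast
        have "y < 2 * l" using that I(2)[OF ij(1)] hubs_subset[of i] by auto
        moreover have "v \<in> insert y (C j)" using eq v by blast
        ultimately have "v \<in> C j" using v blob_hubs_disjoint[of v i] by blast
        then show False using v ij blob_index_eq by blast
      qed
      then show "{insert s (C i), insert t (C i)} \<inter> {insert s (C j), insert t (C j)} = {}"
        by blast
    qed (use F I finite_subset in auto)
    then obtain i where i: "i \<in> I" "insert s (C i) \<notin># F" "insert t (C i) \<notin># F" by blast
    \<comment> \<open>The two surviving links meet in the blob, so \<open>v\<close> joins
      \<open>s\<close> to \<open>t\<close>.\<close>
    obtain v where v: "v \<in> C i" using blob_nonempty by blast
    have "insert s (C i) \<in># edges H" "insert t (C i) \<in># edges H"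
      using i I by (auto simp: edges_hub_hypergraph)
    then show ?thesis
      using edgeR[of "insert s (C i)" s v] edgeR[of "insert t (C i)" v t] i v trR by blast
  qed
  \<comment> \<open>Blobs \<open>l\<close> to \<open>r - 1\<close> are linked to
    \<open>{..<l}\<close>, which contains \<open>0\<close> and \<open>1\<close>; they number
    \<open>r - l \<ge> l\<close>. The blobs below \<open>l\<close>, linked to \<open>{1..l}\<close>,
    then serve the hubs up to \<open>l\<close>.\<close>
  have "(1, 0) \<in> R"
    using l r by (intro hubsR[of "{l..<r}"]) (auto simp: hubs_def half_def)
  moreover have low: "(1, s) \<in> R" if "1 \<le> s" "s \<le> l" for s
    using l r that by (intro hubsR[of "{..<l}"]) (auto simp: hubs_def half_def)
  moreover have "(1, s) \<in> R" if "l < s" "s < 2 * l" for s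
  proof -
    \<comment> \<open>These blobs are linked to the complement of \<open>{..<l}\<close>, that is to
      the hubs from \<open>l\<close> on; hub \<open>l\<close> is already tied to hub
      \<open>1\<close>.\<close>
    have "(l, s) \<in> R"
      using l r that by (intro hubsR[of "{r + l..<2 * r}"]) (auto simp: hubs_def half_def)
    then show ?thesis using trR low[of l] l by simp
  qed
  ultimately have hub1: "(1, s) \<in> R" if "s < 2 * l" for s
    using that by (cases "s = 0"; cases "s \<le> l") auto
  have all: "(1, v) \<in> R" if "v \<in> verts H" for v
    using that hub1 blobR trR unfolding hub_hypergraph_def by simp blast
  have "R \<subseteq> (linked ?D)\<^sup>*" unfolding R_def by (rule rtrancl_mono) simp
  then show "berge_connected ?D"
    using all symR by (intro berge_connectedI[of _ 1]) (auto simp: V)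
qed

section \<open>Parity and the absence of Berge factors\<close>

text \<open>The degrees over the blob sum to \<open>n * k\<close>, which is odd, so some edge meets
  the blob in an odd number of vertices, hence in exactly one.\<close>

lemma leaving_edge:
  assumes G: "multigraph G" "verts G = verts H" "regular k G"
    and sub: "\<And>e. e \<in># edges G \<Longrightarrow> \<exists>e' \<in># edges H. e \<subseteq> e'"
    and odd: "odd k" "odd n" and i: "i < 2 * r"
  obtains s c where "{s, c} \<in># edges G" "s < 2 * l" "c \<in> C i"
proof -
  have "(\<Sum>v\<in>C i. degree G v) = (\<Sum>v\<in>C i. k)"
    using G i by (intro sum.cong) (auto simp: regular_def hub_hypergraph_def)
  then have "(\<Sum>e\<in>#edges G. card (e \<inter> C i)) = n * k"
    using sum_degree[of "C i" G] by (simp add: finite_blob card_blob)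
  then have "odd (\<Sum>e\<in>#edges G. card (e \<inter> C i))" using odd by simp
  moreover have "even (\<Sum>x\<in>#M. f x)" if "\<And>x. x \<in># M \<Longrightarrow> even (f x)"
    for M and f :: "nat set \<Rightarrow> nat"
    using that by (induction M) auto
  ultimately have "\<exists>e. e \<in># edges G \<and> odd (card (e \<inter> C i))" by metis
  then obtain e where e: "e \<in># edges G" "odd (card (e \<inter> C i))" by blast
  have e2: "card e = 2" using G e by (auto simp: multigraph_def)
  obtain e' where "e' \<in># edges H" "e \<subseteq> e'" using sub[OF e(1)] by blast
  then obtain j where j: "e \<subseteq> C j \<or> (\<exists>s\<in>N j. e \<subseteq> insert s (C j))"
    unfolding edges_hub_hypergraph by blast
  have "e \<inter> C i \<noteq> {}" using e(2) by auto
  then obtain c where c: "c \<in> e" "c \<in> C i" by blast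
  have "\<not> e \<subseteq> C i" using e(2) e2 by (auto simp: Int_absorb2)
  \<comment> \<open>Lying in a blob, \<open>c\<close> is no hub, so the edge of \<open>H\<close>
    around \<open>e\<close> belongs to the blob of \<open>c\<close>; the other end of
    \<open>e\<close> must then be a hub linked to it.\<close>
  moreover have "i = j" using j c hubs_subset[of j] blob_index_eq blob_hubs_disjoint by blast
  ultimately obtain s where s: "s \<in> N i" "s \<in> e" "s \<notin> C i" using j by blast
  then have "s \<noteq> c" using c by blast
  then have "{s, c} = e"
    using s c e2 by (intro card_subset_eq) (auto intro: card_ge_0_finite)
  then show ?thesis using that e s c hubs_subset[of i] by blast
qed

text \<open>The \<open>2 * r\<close> leaving edges are different and each ends in a hub, while the
  hubs have total degree \<open>2 * l * k\<close>.\<close>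

lemma no_berge_factor:
  assumes "odd k" "odd n" "k * l < r"
  shows "\<not> berge_factor k H' H"
proof
  assume "berge_factor k H' H"
  then obtain G where G: "multigraph G" "verts G = verts H" "regular k G"
    "\<And>e. e \<in># edges G \<Longrightarrow> \<exists>e' \<in># edges H. e \<subseteq> e'"
    by (rule berge_factor_graph) (rule that)
  have "\<forall>i. \<exists>e. i < 2 * r \<longrightarrow> e \<in># edges G \<and> (\<exists>s c. e = {s, c} \<and> s < 2 * l \<and> c \<in> C i)"
    using leaving_edge[OF G assms(1,2)] by metis
  then obtain g where g: "\<And>i. i < 2 * r \<Longrightarrow>
      g i \<in># edges G \<and> (\<exists>s c. g i = {s, c} \<and> s < 2 * l \<and> c \<in> C i)"
    by metis
  let ?M = "mset_set (g ` {..<2 * r})"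
  \<comment> \<open>A leaving edge has one end in a hub and the other in its blob, so it determines
    the blob.\<close>
  have inj: "inj_on g {..<2 * r}"
  proof (rule inj_onI)
    fix i j assume "i \<in> {..<2 * r}" "j \<in> {..<2 * r}" "g i = g j"
    moreover obtain s c where "g i = {s, c}" "s < 2 * l" "c \<in> C i"
      using g[of i] \<open>i \<in> _\<close> by blast
    moreover obtain s' c' where "g j = {s', c'}" "s' < 2 * l" "c' \<in> C j"
      using g[of j] \<open>j \<in> _\<close> by blast
    ultimately show "i = j"
      using blob_hubs_disjoint blob_index_eq by (metis doubleton_eq_iff)
  qed
  \<comment> \<open>\<open>?M\<close> takes one copy of each leaving edge, so a sum over these edges
    is at most the sum over \<open>edges G\<close>.\<close>
  have "?M \<subseteq># edges G"
  proof (rule subset_mset.order_trans)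
    show "?M \<subseteq># mset_set (set_mset (edges G))"
      using g by (intro subset_imp_msubset_mset_set) auto
  qed (rule mset_set_set_mset_msubset)
  have "2 * r = card (g ` {..<2 * r})" using inj by (simp add: card_image)
  also have "\<dots> \<le> (\<Sum>e\<in>g ` {..<2 * r}. card (e \<inter> {..<2 * l}))"
  proof -
    have "1 \<le> card (e \<inter> {..<2 * l})" if "e \<in> g ` {..<2 * r}" for e
      using that g by (auto simp: Suc_le_eq card_gt_0_iff)
    then have "(\<Sum>e\<in>g ` {..<2 * r}. 1) \<le> (\<Sum>e\<in>g ` {..<2 * r}. card (e \<inter> {..<2 * l}))"
      by (rule sum_mono)
    then show ?thesis by simp
  qed
  also have "\<dots> \<le> (\<Sum>e\<in>#edges G. card (e \<inter> {..<2 * l}))"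
  proof -
    obtain M' where "edges G = ?M + M'"
      using \<open>?M \<subseteq># edges G\<close> by (auto simp: mset_subset_eq_exists_conv)
    then show ?thesis by (simp add: sum_unfold_sum_mset)
  qed
  also have "\<dots> = (\<Sum>v<2 * l. degree G v)"
    by (simp add: sum_degree)
  also have "\<dots> = (\<Sum>v<2 * l. k)"
    using G by (intro sum.cong) (auto simp: regular_def hub_hypergraph_def)
  finally show False using assms(3) by (simp add: mult.commute)
qed

end

section \<open>The infinite family\<close>

theorem theorem5:
  fixes r l t :: nat
  assumes "r \<ge> 2"
    and "2 \<le> l" and "real l \<le> 1 / 2 * real r"
    and "t \<ge> 2"
  shows "\<exists>S :: nat pre_hypergraph set.
    infinite S \<and> pairwise (\<lambda>G H. \<not> hiso G H) S \<and>
    (\<forall>H \<in> S. hypergraph H \<and> edge_connected l H \<and> regular r H \<and>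
       even (card (verts H)) \<and> hrank H \<ge> t \<and>
       (\<forall>k :: nat. odd k \<and> real k < 1 / real l * real r \<longrightarrow>
          \<not> (\<exists>H'. berge_factor k H' H)))"
proof -
  \<comment> \<open>The blob size is odd for the parity argument, at least \<open>t\<close> for the
    rank, and grows with \<open>m\<close>.\<close>
  define h where "h m = hub_hypergraph r l (2 * (t + m) + 1)" for m
  have loc: "hub_construction r l (2 * (t + m) + 1)" for m
    using assms by unfold_locales auto
  have card_h: "card (verts (h m)) = 2 * l + 2 * r * (2 * (t + m) + 1)" for m
    using hub_construction.card_verts[OF loc] by (simp add: h_def)
  \<comment> \<open>The number of vertices determines \<open>m\<close>, so the family is infinite
    and its members are pairwise non-isomorphic.\<close>
  have card_inj: "m = m'" if "card (verts (h m)) = card (verts (h m'))" for m m'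
    using that assms(1) by (simp add: card_h)
  have "k * l < r" if "real k < 1 / real l * real r" for k
  proof -
    have "real (k * l) < real r" using that assms(2) by (simp add: field_simps)
    then show ?thesis by linarith
  qed
  then have "\<not> berge_factor k H' (h m)" if "odd k" "real k < 1 / real l * real r" for k H' m
    using that hub_construction.no_berge_factor[OF loc] by (simp add: h_def)
  moreover have "t \<le> hrank (h m)" for m
    using hub_construction.hrank_hub[OF loc[of m]] by (simp add: h_def)
  moreover have "even (card (verts (h m)))" for m by (simp add: card_h)
  moreover have "hypergraph (h m)" "edge_connected l (h m)" "regular r (h m)" for m
    using loc hub_construction.hypergraph_hub hub_construction.edge_connected_hub
      hub_construction.regular_hub by (auto simp only: h_def)
  moreover have "infinite (range h)"
    using card_inj finite_imageD[of h UNIV] by (metis infinite_UNIV_nat injI)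
  moreover have "pairwise (\<lambda>G H. \<not> hiso G H) (range h)"
    unfolding pairwise_def using card_inj hiso_card_verts by fast
  ultimately show ?thesis by (intro exI[of _ "range h"]) blast
qed

end
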